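(* Let $K$ be a finite simplicial complex, let $\mathcal{V}$ be a multivector field on $K$, let $\mathcal{V}'$ be an atomic rearrangement of $\mathcal{V}$, and let $S$ be a nonempty isolated invariant set under $\mathcal{V}$. Let $S'$ be the isolated invariant set under $\mathcal{V}'$ obtained from $S$ by the continuation step of the Tracking Protocol, that is, one of the following holds: (a) $\mathcal{V}'$ is an atomic refinement of $\mathcal{V}$ and $S'=\mathrm{Inv}_{\mathcal{V}'}(S)$; (b) $\mathcal{V}'$ is an atomic coarsening of $\mathcal{V}$ with merged multivector $V\subseteq S$, and $S'=\mathrm{Inv}_{\mathcal{V}'}(S)$; (c) $\mathcal{V}'$ is an atomic coarsening of $\mathcal{V}$ with merged multivector $V$ satisfying $V\cap S=\emptyset$, and $S'=\mathrm{Inv}_{\mathcal{V}'}(S)$; (d) $\mathcal{V}'$ is an atomic coarsening of $\mathcal{V}$ with merged multivector $V$ satisfying $V\cap S\neq\emptyset$ and $V\not\subseteq S$, the set $A=\langle S\cup V\rangle_{\mathcal{V}'}$ satisfies $\mathrm{Inv}_{\mathcal{V}}(A)=S$, and $S'=\mathrm{Inv}_{\mathcal{V}'}(A)$. If $S''$ is any isolated invariant set under $\mathcal{V}'$ that shares a common index pair with $S$ (i.e. there is a pair $(P,E)$ that is an index pair for $S$ under $\mathcal{V}$ and for $S''$ under $\mathcal{V}'$), then $S'\subseteq S''$. Moreover, if in addition $S''\subseteq S$, then $S'=S''$.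
   Context: $K$ is a finite simplicial complex, viewed as the finite set of its (nonempty) simplices; $\leq$ is the face relation. Homology is simplicial homology with coefficients in a fixed finite field. Closure and mouth: $\mathrm{cl}(\sigma) = \{\tau \in K : \tau \leq \sigma\}$, $\mathrm{cl}(A) = \bigcup_{\sigma\in A}\mathrm{cl}(\sigma)$ for $A\subseteq K$; $A$ is closed if $A=\mathrm{cl}(A)$; $\mathrm{mo}(A) = \mathrm{cl}(A)\setminus A$. A set $A\subseteq K$ is convex if $\sigma\leq\rho\leq\tau$ with $\sigma,\tau\in A$, $\rho\in K$ implies $\rho\in A$. A multivector is a convex subset of $K$; a multivector field on $K$ is a partition of $K$ into multivectors. $[\sigma]_{\mathcal{V}}$ is the unique multivector of $\mathcal{V}$ containing $\sigma$. A multivector $V$ is critical if $H(\mathrm{cl}(V),\mathrm{mo}(V))\neq 0$. A set $A\subseteq K$ is $\mathcal{V}$-compatible if it is a union of multivectors of $\mathcal{V}$. Dynamics: $F_{\mathcal{V}}(\sigma)=\mathrm{cl}(\sigma)\cup[\sigma]_{\mathcal{V}}$, and $F_{\mathcal{V}}(A)=\bigcup_{\sigma\in A}F_{\mathcal{V}}(\sigma)$. A path is a map $\rho:\mathbb{Z}\cap[0,n]\to K$ with $\rho(i+1)\in F_{\mathcal{V}}(\rho(i))$ for $0\le i\le n-1$; a solution is a map $\rho:\mathbb{Z}\to K$ with $\rho(i+1)\in F_{\mathcal{V}}(\rho(i))$ for all $i\in\mathbb{Z}$. A solution $\rho$ is essential if for every $i$ with $[\rho(i)]_{\mathcal{V}}$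 not critical there exist $i^-<i<i^+$ with $[\rho(i^-)]_{\mathcal{V}}\neq[\rho(i)]_{\mathcal{V}}\neq[\rho(i^+)]_{\mathcal{V}}$. Invariant sets: $\mathrm{Inv}_{\mathcal{V}}(A)$ is the set of $\sigma\in A$ for which there is an essential solution $\rho:\mathbb{Z}\to A$ (under $\mathcal{V}$) with $\rho(i)=\sigma$ for some $i$. $S$ is an invariant set under $\mathcal{V}$ if $S=\mathrm{Inv}_{\mathcal{V}}(S)$. An invariant set $S$ is an isolated invariant set under $\mathcal{V}$ if there is a closed set $N$ (an isolating set for $S$) with $F_{\mathcal{V}}(S)\subseteq N$ such that every path $\rho:\mathbb{Z}\cap[0,n]\to N$ with $\rho(0),\rho(n)\in S$ has its whole image in $S$. Index pair: for an isolated invariant set $S$ under $\mathcal{V}$ and closed sets $E\subseteq P\subseteq K$, $(P,E)$ is an index pair for $S$ (under $\mathcal{V}$) if (1) $F_{\mathcal{V}}(P\setminus E)\subseteq P$; (2) $F_{\mathcal{V}}(E)\cap P\subseteq E$; (3) $S=\mathrm{Inv}_{\mathcal{V}}(P\setminus E)$. Atomic rearrangements: $\mathcal{V}'$ is an atomic refinement of $\mathcal{V}$ if each multivector of $\mathcal{V}'$ is contained in a multivector of $\mathcal{V}$, $|\mathcal{V}\setminus\mathcal{V}'|=1$ and $|\mathcal{V}'\setminus\mathcal{V}|=2$. $\mathcal{V}'$ is an atomic coarsening of $\mathcal{V}$ if $\mathcal{V}$ is an atomic refinement of $\mathcal{V}'$; then the unique element of $\mathcal{V}'\setminus\mathcal{V}$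 is the merged multivector. In either case $\mathcal{V}'$ is an atomic rearrangement of $\mathcal{V}$. $\langle S\cup V\rangle_{\mathcal{V}'}$ denotes the intersection of all $\mathcal{V}'$-compatible and convex subsets of $K$ that contain $S\cup V$. *)

theory Defs
  imports
    "HOL-Algebra.Elementary_Groups"
    "HOL-Combinatorics.Permutations"
    "HOL-Library.Disjoint_Sets"
begin

definition finite_simplicial_complex :: "'a set set \<Rightarrow> bool" where
  "finite_simplicial_complex K \<longleftrightarrow>
     finite K \<and> (\<forall>\<sigma>\<in>K. finite \<sigma> \<and> \<sigma> \<noteq> {}) \<and>
     (\<forall>\<sigma>\<in>K. \<forall>\<tau>. \<tau> \<subseteq> \<sigma> \<longrightarrow> \<tau> \<noteq> {} \<longrightarrow> \<tau> \<in> K)"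

text \<open>
  A simplicial \<open>n\<close>-chain of a complex \<open>X\<close> is an alternating function on the ordered
  \<open>n\<close>-simplices of \<open>X\<close>, i.e. on the distinct lists of \<open>n + 1\<close> vertices spanning a simplex
  of \<open>X\<close>. The value \<open>c xs\<close> is the coefficient of the oriented simplex given by \<open>xs\<close>; thus no
  linear order on the vertices has to be chosen.
\<close>

definition simp_chains :: "nat \<Rightarrow> 'a set set \<Rightarrow> ('a list \<Rightarrow> 'f::field) set" where
  "simp_chains n X =
     {c. (\<forall>xs. c xs \<noteq> 0 \<longrightarrow> distinct xs \<and> length xs = Suc n \<and> set xs \<in> X) \<and>
         (\<forall>xs p. p permutes {..<length xs} \<longrightarrow>
            c (permute_list p xs) = of_int (sign p) * c xs)}"

text \<open>
  From \<open>\<partial>[v\<^sub>0, \<dots>, v\<^sub>n] = (\<Sum>i\<le>n. (-1)\<^sup>i [v\<^sub>0, \<dots>, v\<^sub>i\<^sub>-\<^sub>1, v\<^sub>i\<^sub>+\<^sub>1, \<dots>, v\<^sub>n])\<close> the coefficient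
  of \<open>\<partial>c\<close> at \<open>xs\<close> is the sum of the coefficients of \<open>c\<close> at all \<open>v # xs\<close>. The case \<open>xs = []\<close>
  makes the boundary of every 0-chain vanish (homology is not reduced).
\<close>

definition simp_boundary :: "('a list \<Rightarrow> 'f::field) \<Rightarrow> 'a list \<Rightarrow> 'f" where
  "simp_boundary c xs = (if xs = [] then 0 else \<Sum>v | c (v # xs) \<noteq> 0. c (v # xs))"

text \<open>
  As boundaries of 0-chains are zero, the truncation in \<open>n - 1\<close> is harmless: for
  \<open>n = 0\<close> the condition on the boundary is vacuous.
\<close>

definition rel_cycles :: "nat \<Rightarrow> 'a set set \<Rightarrow> 'a set set \<Rightarrow> ('a list \<Rightarrow> 'f::field) set" where
  "rel_cycles n X A = {c \<in> simp_chains n X. simp_boundary c \<in> simp_chains (n - 1) A}"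

definition rel_boundaries :: "nat \<Rightarrow> 'a set set \<Rightarrow> 'a set set \<Rightarrow> ('a list \<Rightarrow> 'f::field) set" where
  "rel_boundaries n X A =
     {\<lambda>xs. simp_boundary e xs + d xs | e d. e \<in> simp_chains (Suc n) X \<and> d \<in> simp_chains n A}"

definition rel_cycle_group :: "nat \<Rightarrow> 'a set set \<Rightarrow> 'a set set \<Rightarrow> ('a list \<Rightarrow> 'f::field) monoid" where
  "rel_cycle_group n X A =
     \<lparr>carrier = rel_cycles n X A, monoid.mult = (\<lambda>c d xs. c xs + d xs), one = (\<lambda>xs. 0)\<rparr>"

definition rel_homology_group ::
  "nat \<Rightarrow> 'a set set \<Rightarrow> 'a set set \<Rightarrow> ('a list \<Rightarrow> 'f::field) set monoid" where
  "rel_homology_group n X A = rel_cycle_group n X A Mod rel_boundaries n X A"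

definition simplex_cl :: "'a set set \<Rightarrow> 'a set \<Rightarrow> 'a set set" where
  "simplex_cl K \<sigma> = {\<tau> \<in> K. \<tau> \<subseteq> \<sigma>}"

definition cl :: "'a set set \<Rightarrow> 'a set set \<Rightarrow> 'a set set" where
  "cl K A = (\<Union>\<sigma>\<in>A. simplex_cl K \<sigma>)"

definition mo :: "'a set set \<Rightarrow> 'a set set \<Rightarrow> 'a set set" where
  "mo K A = cl K A - A"

definition closed_in_complex :: "'a set set \<Rightarrow> 'a set set \<Rightarrow> bool" where
  "closed_in_complex K A \<longleftrightarrow> A \<subseteq> K \<and> A = cl K A"

definition convex_in_complex :: "'a set set \<Rightarrow> 'a set set \<Rightarrow> bool" where
  "convex_in_complex K A \<longleftrightarrow>
     A \<subseteq> K \<and> (\<forall>\<sigma>\<in>A. \<forall>\<tau>\<in>A. \<forall>\<rho>\<in>K. \<sigma> \<subseteq> \<rho> \<and> \<rho> \<subseteq> \<tau> \<longrightarrow> \<rho> \<in> A)"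

definition multivector_field :: "'a set set \<Rightarrow> 'a set set set \<Rightarrow> bool" where
  "multivector_field K \<V> \<longleftrightarrow> partition_on K \<V> \<and> (\<forall>V\<in>\<V>. convex_in_complex K V)"

definition multivector_of :: "'a set set set \<Rightarrow> 'a set \<Rightarrow> 'a set set" where
  "multivector_of \<V> \<sigma> = (THE V. V \<in> \<V> \<and> \<sigma> \<in> V)"

definition compatible :: "'a set set set \<Rightarrow> 'a set set \<Rightarrow> bool" where
  "compatible \<V> A \<longleftrightarrow> (\<exists>\<U>\<subseteq>\<V>. A = \<Union>\<U>)"

text \<open>
  The type argument \<open>'f\<close> is the coefficient field. The graded homology is nonzero iff it is
  nonzero in some degree.
\<close>

definition critical :: "'f::{field,finite} itself \<Rightarrow> 'a set set \<Rightarrow> 'a set set \<Rightarrow> bool" where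
  "critical _ K V \<longleftrightarrow>
     (\<exists>n. \<not> trivial_group
        (rel_homology_group n (cl K V) (mo K V) :: ('a list \<Rightarrow> 'f) set monoid))"

definition F_mv :: "'a set set \<Rightarrow> 'a set set set \<Rightarrow> 'a set \<Rightarrow> 'a set set" where
  "F_mv K \<V> \<sigma> = simplex_cl K \<sigma> \<union> multivector_of \<V> \<sigma>"

definition F_set :: "'a set set \<Rightarrow> 'a set set set \<Rightarrow> 'a set set \<Rightarrow> 'a set set" where
  "F_set K \<V> A = (\<Union>\<sigma>\<in>A. F_mv K \<V> \<sigma>)"

definition mv_path :: "'a set set \<Rightarrow> 'a set set set \<Rightarrow> nat \<Rightarrow> (nat \<Rightarrow> 'a set) \<Rightarrow> bool" where
  "mv_path K \<V> n \<rho> \<longleftrightarrow> (\<forall>i\<le>n. \<rho> i \<in> K) \<and> (\<forall>i<n. \<rho> (i + 1) \<in> F_mv K \<V> (\<rho> i))"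

definition mv_solution :: "'a set set \<Rightarrow> 'a set set set \<Rightarrow> (int \<Rightarrow> 'a set) \<Rightarrow> bool" where
  "mv_solution K \<V> \<rho> \<longleftrightarrow> (\<forall>i. \<rho> i \<in> K) \<and> (\<forall>i. \<rho> (i + 1) \<in> F_mv K \<V> (\<rho> i))"

definition essential_solution ::
  "'f::{field,finite} itself \<Rightarrow> 'a set set \<Rightarrow> 'a set set set \<Rightarrow> (int \<Rightarrow> 'a set) \<Rightarrow> bool" where
  "essential_solution F K \<V> \<rho> \<longleftrightarrow>
     mv_solution K \<V> \<rho> \<and>
     (\<forall>i. \<not> critical F K (multivector_of \<V> (\<rho> i)) \<longrightarrow>
        (\<exists>j k. j < i \<and> i < k \<and>
           multivector_of \<V> (\<rho> j) \<noteq> multivector_of \<V> (\<rho> i) \<and>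
           multivector_of \<V> (\<rho> i) \<noteq> multivector_of \<V> (\<rho> k)))"

definition Inv_mv ::
  "'f::{field,finite} itself \<Rightarrow> 'a set set \<Rightarrow> 'a set set set \<Rightarrow> 'a set set \<Rightarrow> 'a set set" where
  "Inv_mv F K \<V> A =
     {\<sigma> \<in> A. \<exists>\<rho>. essential_solution F K \<V> \<rho> \<and> (\<forall>i. \<rho> i \<in> A) \<and> (\<exists>i. \<rho> i = \<sigma>)}"

definition invariant_set ::
  "'f::{field,finite} itself \<Rightarrow> 'a set set \<Rightarrow> 'a set set set \<Rightarrow> 'a set set \<Rightarrow> bool" where
  "invariant_set F K \<V> S \<longleftrightarrow> S \<subseteq> K \<and> S = Inv_mv F K \<V> S"

definition isolated_by :: "'a set set \<Rightarrow> 'a set set set \<Rightarrow> 'a set set \<Rightarrow> 'a set set \<Rightarrow> bool" where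
  "isolated_by K \<V> S N \<longleftrightarrow>
     closed_in_complex K N \<and> F_set K \<V> S \<subseteq> N \<and>
     (\<forall>n \<rho>. mv_path K \<V> n \<rho> \<and> (\<forall>i\<le>n. \<rho> i \<in> N) \<and> \<rho> 0 \<in> S \<and> \<rho> n \<in> S \<longrightarrow>
        (\<forall>i\<le>n. \<rho> i \<in> S))"

definition isolated_invariant_set ::
  "'f::{field,finite} itself \<Rightarrow> 'a set set \<Rightarrow> 'a set set set \<Rightarrow> 'a set set \<Rightarrow> bool" where
  "isolated_invariant_set F K \<V> S \<longleftrightarrow>
     invariant_set F K \<V> S \<and> (\<exists>N. isolated_by K \<V> S N)"

definition index_pair ::
  "'f::{field,finite} itself \<Rightarrow> 'a set set \<Rightarrow> 'a set set set \<Rightarrow> 'a set set \<Rightarrow>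
   'a set set \<Rightarrow> 'a set set \<Rightarrow> bool" where
  "index_pair F K \<V> S P E \<longleftrightarrow>
     isolated_invariant_set F K \<V> S \<and>
     closed_in_complex K P \<and> closed_in_complex K E \<and> E \<subseteq> P \<and>
     F_set K \<V> (P - E) \<subseteq> P \<and>
     F_set K \<V> E \<inter> P \<subseteq> E \<and>
     S = Inv_mv F K \<V> (P - E)"

text \<open>In the next three predicates, \<open>\<V>'\<close> is the field obtained by rearranging \<open>\<V>\<close>.\<close>

definition atomic_refinement :: "'a set set set \<Rightarrow> 'a set set set \<Rightarrow> bool" where
  "atomic_refinement \<V>' \<V> \<longleftrightarrow>
     (\<forall>W\<in>\<V>'. \<exists>V\<in>\<V>. W \<subseteq> V) \<and> card (\<V> - \<V>') = 1 \<and> card (\<V>' - \<V>) = 2"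

definition atomic_coarsening :: "'a set set set \<Rightarrow> 'a set set set \<Rightarrow> bool" where
  "atomic_coarsening \<V>' \<V> \<longleftrightarrow> atomic_refinement \<V> \<V>'"

definition atomic_rearrangement :: "'a set set set \<Rightarrow> 'a set set set \<Rightarrow> bool" where
  "atomic_rearrangement \<V>' \<V> \<longleftrightarrow> atomic_refinement \<V>' \<V> \<or> atomic_coarsening \<V>' \<V>"

definition compatible_convex_hull :: "'a set set \<Rightarrow> 'a set set set \<Rightarrow> 'a set set \<Rightarrow> 'a set set" where
  "compatible_convex_hull K \<V> B =
     \<Inter>{C. C \<subseteq> K \<and> compatible \<V> C \<and> convex_in_complex K C \<and> B \<subseteq> C}"

end

theory Submission
  imports Defs
begin

text \<open>
  If \<open>(P, E)\<close> is an index pair under \<open>\<V>'\<close>, then \<open>P - E\<close> is convex and \<open>\<V>'\<close>-compatible. Hence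
  \<open>P - E\<close> contains the hull \<open>\<langle>S \<union> V\<rangle>\<close> as soon as it contains \<open>S\<close> and meets \<open>V\<close>. In all four
  cases of the continuation step, \<open>S' = Inv A\<close> for some \<open>A\<close> with \<open>S \<subseteq> A \<subseteq> P - E\<close>, and monotonicity
  of \<open>Inv\<close> gives both claims.
\<close>

lemma Inv_mv_mono:
  assumes "A \<subseteq> B"
  shows "Inv_mv F K \<V> A \<subseteq> Inv_mv F K \<V> B"
  using assms unfolding Inv_mv_def by blast

lemma multivector_of_eq:
  assumes "partition_on K \<V>" and "V \<in> \<V>" and "\<sigma> \<in> V"
  shows "multivector_of \<V> \<sigma> = V"
  unfolding multivector_of_def
proof (rule the_equality)
  show "V \<in> \<V> \<and> \<sigma> \<in> V"
    using assms by blast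
  show "W = V" if "W \<in> \<V> \<and> \<sigma> \<in> W" for W
    using that assms by (auto simp: partition_on_def disjoint_def)
qed

lemma closed_in_complexD:
  assumes "closed_in_complex K A" and "\<sigma> \<in> A" and "\<tau> \<in> K" and "\<tau> \<subseteq> \<sigma>"
  shows "\<tau> \<in> A"
  using assms unfolding closed_in_complex_def cl_def simplex_cl_def by blast

text \<open>For \<open>\<sigma> \<subseteq> \<rho> \<subseteq> \<tau>\<close> with both ends in
  \<open>P - E\<close>, closedness of \<open>P\<close> passes membership from \<open>\<tau>\<close>
  down to \<open>\<rho>\<close>, while closedness of \<open>E\<close> keeps \<open>\<rho>\<close>
  out of \<open>E\<close>, since otherwise \<open>\<sigma>\<close> would lie in
  \<open>E\<close>.\<close>

lemma convex_in_complex_closed_diff: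
  assumes "closed_in_complex K P" and "closed_in_complex K E"
  shows "convex_in_complex K (P - E)"
proof -
  have "P \<subseteq> K"
    using assms(1) by (simp add: closed_in_complex_def)
  then show ?thesis
    unfolding convex_in_complex_def
    using closed_in_complexD[OF assms(1)] closed_in_complexD[OF assms(2)] by blast
qed

text \<open>All points of a multivector reach one another in one step of the dynamics. Starting at
  \<open>\<sigma>\<close>, the first index pair condition puts \<open>V\<close> inside
  \<open>P\<close>. A point of \<open>V\<close> in \<open>E\<close> would reach
  \<open>\<sigma>\<close>, which lies in \<open>P\<close>, and the second condition would force
  \<open>\<sigma>\<close> into \<open>E\<close>.\<close>

lemma index_pair_multivector_subset:
  assumes \<V>: "multivector_field K \<V>" and PE: "index_pair F K \<V> S P E"
    and V: "V \<in> \<V>" and \<sigma>: "\<sigma> \<in> V" "\<sigma> \<in> P - E"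
  shows "V \<subseteq> P - E"
proof
  fix \<tau> assume \<tau>: "\<tau> \<in> V"
  have part: "partition_on K \<V>"
    using \<V> by (simp add: multivector_field_def)
  have "V \<subseteq> F_mv K \<V> \<sigma>" "V \<subseteq> F_mv K \<V> \<tau>"
    using multivector_of_eq[OF part V] \<sigma>(1) \<tau> by (auto simp: F_mv_def)
  moreover have "F_set K \<V> (P - E) \<subseteq> P" "F_set K \<V> E \<inter> P \<subseteq> E"
    using PE by (auto simp: index_pair_def)
  ultimately show "\<tau> \<in> P - E"
    using \<sigma> \<tau> unfolding F_set_def by blast
qed

lemma index_pair_compatible:
  assumes \<V>: "multivector_field K \<V>" and PE: "index_pair F K \<V> S P E"
  shows "compatible \<V> (P - E)"
proof -
  have "\<Union>\<V> = K"
    using \<V> by (simp add: multivector_field_def partition_on_def)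
  moreover have "P \<subseteq> K"
    using PE by (simp add: index_pair_def closed_in_complex_def)
  ultimately have "P - E \<subseteq> \<Union>\<V>"
    by blast
  have "P - E = \<Union>{V \<in> \<V>. V \<subseteq> P - E}"
  proof (intro equalityI subsetI)
    fix \<sigma> assume \<sigma>: "\<sigma> \<in> P - E"
    then obtain V where V: "V \<in> \<V>" "\<sigma> \<in> V"
      using \<open>P - E \<subseteq> \<Union>\<V>\<close> by blast
    then have "V \<subseteq> P - E"
      using index_pair_multivector_subset[OF assms] \<sigma> by blast
    then show "\<sigma> \<in> \<Union>{V \<in> \<V>. V \<subseteq> P - E}"
      using V by blast
  qed blast
  then show ?thesis
    unfolding compatible_def by (intro exI[of _ "{V \<in> \<V>. V \<subseteq> P - E}"]) simp
qed

text \<open>The set \<open>P - E\<close> is itself one of the sets whose intersection defines the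
  hull.\<close>

lemma compatible_convex_hull_subset_index_pair:
  assumes \<V>: "multivector_field K \<V>" and PE: "index_pair F K \<V> S P E"
    and "B \<subseteq> P - E"
  shows "compatible_convex_hull K \<V> B \<subseteq> P - E"
proof -
  have "convex_in_complex K (P - E)"
    using PE by (intro convex_in_complex_closed_diff) (simp_all add: index_pair_def)
  moreover from this have "P - E \<subseteq> K"
    by (simp add: convex_in_complex_def)
  ultimately show ?thesis
    using index_pair_compatible[OF \<V> PE] \<open>B \<subseteq> P - E\<close>
    unfolding compatible_convex_hull_def
    by (intro Inter_lower CollectI conjI)
qed

lemma subset_compatible_convex_hull: "B \<subseteq> compatible_convex_hull K \<V> B"
  unfolding compatible_convex_hull_def by blast

theorem proposition18:
  fixes K :: "'a set set" and \<V> \<V>' :: "'a set set set" and S S' S'' :: "'a set set"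
    and coeff :: "'f::{field,finite} itself"
  assumes "finite_simplicial_complex K"
    and "multivector_field K \<V>" and "multivector_field K \<V>'"
    and "atomic_rearrangement \<V>' \<V>"
    and "isolated_invariant_set coeff K \<V> S" and "S \<noteq> {}"
    and continuation:
      "(atomic_refinement \<V>' \<V> \<and> S' = Inv_mv coeff K \<V>' S) \<or>
       (\<exists>V. atomic_coarsening \<V>' \<V> \<and> \<V>' - \<V> = {V} \<and> V \<subseteq> S \<and>
          S' = Inv_mv coeff K \<V>' S) \<or>
       (\<exists>V. atomic_coarsening \<V>' \<V> \<and> \<V>' - \<V> = {V} \<and> V \<inter> S = {} \<and>
          S' = Inv_mv coeff K \<V>' S) \<or>
       (\<exists>V A. atomic_coarsening \<V>' \<V> \<and> \<V>' - \<V> = {V} \<and> V \<inter> S \<noteq> {} \<and> \<not> V \<subseteq> S \<and>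
          A = compatible_convex_hull K \<V>' (S \<union> V) \<and> Inv_mv coeff K \<V> A = S \<and>
          S' = Inv_mv coeff K \<V>' A)"
    and "isolated_invariant_set coeff K \<V>' S''"
    and "\<exists>P E. index_pair coeff K \<V> S P E \<and> index_pair coeff K \<V>' S'' P E"
  shows "S' \<subseteq> S'' \<and> (S'' \<subseteq> S \<longrightarrow> S' = S'')"
proof -
  obtain P E where PE: "index_pair coeff K \<V> S P E" and PE': "index_pair coeff K \<V>' S'' P E"
    using assms(9) by blast
  have "S = Inv_mv coeff K \<V> (P - E)"
    using PE by (simp add: index_pair_def)
  then have S: "S \<subseteq> P - E"
    by (auto simp: Inv_mv_def)
  have S''_Inv: "S'' = Inv_mv coeff K \<V>' (P - E)"
    using PE' by (simp add: index_pair_def)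
  have S''_inv: "S'' = Inv_mv coeff K \<V>' S''"
    using assms(8) by (simp add: isolated_invariant_set_def invariant_set_def)
  \<comment> \<open>If \<open>S'\<close> is the invariant part of \<open>S\<close>, then
    \<open>A = S\<close> works. Otherwise only the last continuation case remains, and
    \<open>A\<close> is the hull of \<open>S \<union> V\<close>.\<close>
  obtain A where A: "S \<subseteq> A" "A \<subseteq> P - E" "S' = Inv_mv coeff K \<V>' A"
  proof (cases "S' = Inv_mv coeff K \<V>' S")
    case True
    then show ?thesis by (rule that[OF order_refl S])
  next
    case False
    then obtain V where V: "\<V>' - \<V> = {V}" "V \<inter> S \<noteq> {}"
        and S': "S' = Inv_mv coeff K \<V>' (compatible_convex_hull K \<V>' (S \<union> V))"
      using continuation by (simp only: simp_thms) metis
    \<comment> \<open>The merged multivector belongs to \<open>\<V>'\<close> and meets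
      \<open>S\<close>, hence meets \<open>P - E\<close>, so the index pair for \<open>S''\<close>
      under \<open>\<V>'\<close> applies.\<close>
    have "V \<subseteq> P - E"
      using index_pair_multivector_subset[OF assms(3) PE'] V S by blast
    then have "compatible_convex_hull K \<V>' (S \<union> V) \<subseteq> P - E"
      using S by (intro compatible_convex_hull_subset_index_pair[OF assms(3) PE']) blast
    then show ?thesis
      using subset_compatible_convex_hull[of "S \<union> V" K \<V>'] by (intro that[OF _ _ S']) auto
  qed
  have "S' \<subseteq> S''"
    unfolding A(3) S''_Inv using A(2) by (rule Inv_mv_mono)
  \<comment> \<open>Since \<open>S''\<close> is invariant under \<open>\<V>'\<close>, it equals its
    own invariant part, and \<open>S'' \<subseteq> S \<subseteq> A\<close> allows
    monotonicity.\<close>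
  moreover have "S'' \<subseteq> S'" if "S'' \<subseteq> S"
    unfolding A(3) using Inv_mv_mono[OF order_trans[OF that A(1)]] by (subst S''_inv)
  ultimately show ?thesis by blast
qed

end
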